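(* Let $q\in(0,1)$ and $0<a<b$. Let $f,g:[0,b]\to\mathbb{R}$ be two increasing functions. Suppose there exist constants $l_f,L_f,l_g,L_g$ such that $a^2/b^2\le l_f/L_f$, $a^2/b^2\le l_g/L_g$, and for all $x,y\in[0,b]$ with $x\ne y$, $$l_f\le\frac{f(x)-f(y)}{x-y}\le L_f,\qquad l_g\le\frac{g(x)-g(y)}{x-y}\le L_g .$$ Then the following inequalities hold: (a) $\displaystyle I_q(fg;a,b)\ge\frac{1}{b-a}I_q(f;a,b)\,I_q(g;a,b)-\frac{ab(b-a)}{[3]_q}L_fL_g;$ (b) $\displaystyle I_q(fg;a,b)\ge\frac{1}{b-a}I_q(f;a,b)\,I_q(g;a,b)-\frac{ab}{b-a}\bigl(f(b)-f(0)\bigr)\bigl(g(b)-g(0)\bigr).$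
   Context: For $q\in(0,1)$ and $c>0$, $I_q(h;0,c)=c(1-q)\sum_{k=0}^{\infty}h(cq^k)q^k$, and for $0<a<b$, $I_q(h;a,b)=I_q(h;0,b)-I_q(h;0,a)$. Also $[n]_q=\frac{1-q^n}{1-q}$, so $[3]_q=1+q+q^2$. *)

theory Defs
  imports "HOL-Analysis.Analysis"
begin

definition q_number :: "real \<Rightarrow> nat \<Rightarrow> real" where
  "q_number q n = (1 - q ^ n) / (1 - q)"

(* Jackson integral over [0,c], for 0 < q < 1 and c > 0.  It samples h only at the points
   c q^k of [0,c].  The library's suminf is the ordinary sum when the series converges, as it
   does for h bounded on [0,c]. *)
definition q_integral0 :: "real \<Rightarrow> (real \<Rightarrow> real) \<Rightarrow> real \<Rightarrow> real" where
  "q_integral0 q h c = c * (1 - q) * (\<Sum>k. h (c * q ^ k) * q ^ k)"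

definition q_integral :: "real \<Rightarrow> (real \<Rightarrow> real) \<Rightarrow> real \<Rightarrow> real \<Rightarrow> real" where
  "q_integral q h a b = q_integral0 q h b - q_integral0 q h a"

end

theory Submission
  imports Defs
begin

text \<open>
  A Jackson integral over \<open>[0,c]\<close> is \<open>c\<close> times the mean of the samples \<open>h (c q^k)\<close> with respect
  to the geometric probability weights \<open>(1 - q) q^k\<close>. Write \<open>E\<^sub>a, E\<^sub>b\<close> for the means
  over the points \<open>a q^k\<close> and \<open>b q^k\<close>, \<open>C\<^sub>a, C\<^sub>b\<close> for the corresponding covariances of \<open>f\<close>
  and \<open>g\<close>, and \<open>I\<close> for the Jackson integral over \<open>[a,b]\<close>. Expanding gives the identity
  \<open>(b - a) I(f g) - I(f) I(g)
     = b (b - a) C\<^sub>b - a (b - a) C\<^sub>a - a b (E\<^sub>b f - E\<^sub>a f) (E\<^sub>b g - E\<^sub>a g)\<close>,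
  so that both inequalities reduce to bounds on the three terms on the right.

  A covariance is half the mean of \<open>(u j - u k) (v j - v k)\<close> over independent \<open>j, k\<close>, so a
  pointwise comparison of these products compares covariances (\<open>geo_cov_le\<close>). For (a), let
  \<open>V\<close> and \<open>M\<close> be the variance and the mean of \<open>q^k\<close>. The slope bounds yield
  \<open>C\<^sub>b \<ge> l_f l_g b^2 V \<ge> (a^4 / b^2) L_f L_g V\<close>, \<open>C\<^sub>a \<le> L_f L_g a^2 V\<close> and
  \<open>0 \<le> E\<^sub>b f - E\<^sub>a f \<le> L_f (b - a) M\<close>, and likewise for \<open>g\<close>. Hence
  \<open>b C\<^sub>b - a C\<^sub>a \<ge> - (b - a) (a^3 / b) L_f L_g V\<close>, and the claim follows from
  \<open>a^3 / b \<le> a b\<close> and \<open>V + M^2 = 1 / (1 + q + q^2)\<close>. For (b), \<open>C\<^sub>b \<ge> 0\<close>, while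
  \<open>C\<^sub>a \<le> (E\<^sub>a f - f 0) (g b - E\<^sub>a g)\<close> (\<open>geo_cov_le_bounds\<close>) and
  \<open>0 \<le> E\<^sub>b f - E\<^sub>a f \<le> f b - E\<^sub>a f\<close>, and likewise for \<open>g\<close>. Since \<open>b - a \<le> b\<close>, the two
  subtracted terms of the identity add up to at most \<open>a b\<close> times
  \<open>(E\<^sub>a f - f 0) (g b - E\<^sub>a g) + (f b - E\<^sub>a f) (g b - E\<^sub>a g) = (f b - f 0) (g b - E\<^sub>a g)\<close>,
  and \<open>E\<^sub>a g \<ge> g 0\<close>.
\<close>

section \<open>Means and covariances with geometric weights\<close>

text \<open>The mean of a sequence with respect to the probability weights \<open>(1 - q) q^k\<close> on the natural
  numbers; it is meaningful for \<open>0 < q < 1\<close> and bounded sequences.\<close>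
definition geo_mean :: "real \<Rightarrow> (nat \<Rightarrow> real) \<Rightarrow> real" where
  "geo_mean q u = (1 - q) * (\<Sum>k. u k * q ^ k)"

text \<open>The covariance of two sequences with respect to the same weights.\<close>
definition geo_cov :: "real \<Rightarrow> (nat \<Rightarrow> real) \<Rightarrow> (nat \<Rightarrow> real) \<Rightarrow> real" where
  "geo_cov q u v = geo_mean q (\<lambda>k. u k * v k) - geo_mean q u * geo_mean q v"

lemma q_integral0_eq_geo_mean: "q_integral0 q h c = c * geo_mean q (\<lambda>k. h (c * q ^ k))"
  by (simp add: q_integral0_def geo_mean_def)

lemma Bseq_diff_real:
  fixes u v :: "nat \<Rightarrow> real"
  assumes "Bseq u" "Bseq v"
  shows "Bseq (\<lambda>k. u k - v k)"
proof -
  obtain K where K: "\<And>k. \<bar>u k\<bar> \<le> K"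
    using assms(1) by (auto simp: Bseq_def)
  obtain L where L: "\<And>k. \<bar>v k\<bar> \<le> L"
    using assms(2) by (auto simp: Bseq_def)
  have "\<bar>u k - v k\<bar> \<le> K + L" for k
    using K[of k] L[of k] by linarith
  then show ?thesis
    by (intro BseqI'[of _ "K + L"]) simp
qed

lemma Bseq_geometric:
  assumes "0 < q" "q < (1::real)"
  shows "Bseq (\<lambda>k. c * q ^ k)"
proof (rule BseqI')
  show "norm (c * q ^ k) \<le> \<bar>c\<bar>" for k
    using assms mult_left_mono[of "q ^ k" 1 "\<bar>c\<bar>"] by (simp add: abs_mult power_le_one)
qed

lemma summable_geo:
  fixes u :: "nat \<Rightarrow> real"
  assumes q: "0 < q" "q < 1" and "Bseq u"
  shows "summable (\<lambda>k. u k * q ^ k)"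
proof -
  obtain K where K: "\<And>k. \<bar>u k\<bar> \<le> K"
    using assms(3) by (auto simp: Bseq_def)
  show ?thesis
  proof (rule summable_comparison_test')
    show "summable (\<lambda>k. K * q ^ k)"
      using q by (intro summable_mult summable_geometric) simp
    show "norm (u k * q ^ k) \<le> K * q ^ k" for k
      using K[of k] q by (simp add: abs_mult mult_right_mono)
  qed
qed

lemma geo_mean_const:
  assumes "0 < q" "q < 1"
  shows "geo_mean q (\<lambda>k. c) = c"
  using assms by (simp add: geo_mean_def suminf_mult suminf_geometric summable_geometric)

lemma geo_mean_cmult:
  assumes "0 < q" "q < 1" "Bseq u"
  shows "geo_mean q (\<lambda>k. c * u k) = c * geo_mean q u"
  using suminf_mult[OF summable_geo[OF assms], of c] by (simp add: geo_mean_def mult.assoc)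

lemma geo_mean_diff:
  assumes "0 < q" "q < 1" "Bseq u" "Bseq v"
  shows "geo_mean q (\<lambda>k. u k - v k) = geo_mean q u - geo_mean q v"
proof -
  have "(\<Sum>k. (u k - v k) * q ^ k) = (\<Sum>k. u k * q ^ k) - (\<Sum>k. v k * q ^ k)"
    using suminf_diff[OF summable_geo[OF assms(1-3)] summable_geo[OF assms(1,2,4)]]
    by (simp add: left_diff_distrib)
  then show ?thesis
    by (simp only: geo_mean_def right_diff_distrib)
qed

lemma geo_mean_mono:
  assumes "0 < q" "q < 1" "Bseq u" "Bseq v" "\<And>k. u k \<le> v k"
  shows "geo_mean q u \<le> geo_mean q v"
  unfolding geo_mean_def using assms
  by (intro mult_left_mono suminf_le summable_geo mult_right_mono) auto

lemma geo_mean_bounds: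
  assumes q: "0 < q" "q < 1" and "Bseq u" "\<And>k. m \<le> u k" "\<And>k. u k \<le> M"
  shows "m \<le> geo_mean q u" "geo_mean q u \<le> M"
  using geo_mean_mono[OF q _ assms(3), of "\<lambda>_. m"] geo_mean_mono[OF q assms(3), of "\<lambda>_. M"]
    assms(4,5) by (simp_all add: geo_mean_const[OF q] Bfun_const)

text \<open>The mean of a product of two differences from constants.\<close>
lemma geo_mean_prod_diff:
  assumes q: "0 < q" "q < 1" and u: "Bseq u" and v: "Bseq v"
  shows "geo_mean q (\<lambda>k. (u k - s) * (v k - t))
    = geo_mean q (\<lambda>k. u k * v k) - t * geo_mean q u - s * geo_mean q v + s * t"
proof -
  have c: "Bseq (\<lambda>k::nat. x)" for x :: real
    by (simp add: Bfun_const)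
  have tu: "Bseq (\<lambda>k. t * u k)" and sv: "Bseq (\<lambda>k. s * v k)" and uv: "Bseq (\<lambda>k. u k * v k)"
    using Bseq_mult[OF c u] Bseq_mult[OF c v] Bseq_mult[OF u v] by auto
  have "geo_mean q (\<lambda>k. (u k - s) * (v k - t))
      = geo_mean q (\<lambda>k. ((u k * v k - t * u k) - s * v k) - (- (s * t)))"
    by (rule arg_cong[of _ _ "geo_mean q"]) (auto simp: algebra_simps)
  also have "\<dots> = geo_mean q (\<lambda>k. u k * v k) - t * geo_mean q u - s * geo_mean q v + s * t"
    unfolding geo_mean_diff[OF q Bseq_diff_real[OF Bseq_diff_real[OF uv tu] sv] c]
      geo_mean_diff[OF q Bseq_diff_real[OF uv tu] sv] geo_mean_diff[OF q uv tu]
      geo_mean_cmult[OF q u] geo_mean_cmult[OF q v] geo_mean_const[OF q] by simp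
  finally show ?thesis .
qed

text \<open>The covariance as half the mean of \<open>(u k - u m) (v k - v m)\<close> over independent indices.\<close>
lemma geo_mean_geo_mean_diffs:
  assumes q: "0 < q" "q < 1" and u: "Bseq u" and v: "Bseq v"
  shows "Bseq (\<lambda>m. geo_mean q (\<lambda>k. (u k - u m) * (v k - v m)))" (is ?bounded)
    and "geo_mean q (\<lambda>m. geo_mean q (\<lambda>k. (u k - u m) * (v k - v m))) = 2 * geo_cov q u v"
      (is ?mean)
proof -
  define U V P where "U = geo_mean q u" "V = geo_mean q v" "P = geo_mean q (\<lambda>k. u k * v k)"
  have eq: "geo_mean q (\<lambda>k. (u k - u m) * (v k - v m)) = (u m - U) * (v m - V) - (U * V - P)" for m
    unfolding geo_mean_prod_diff[OF assms] U_V_P_def by (simp add: algebra_simps)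
  have c: "Bseq (\<lambda>k::nat. x)" for x :: real
    by (simp add: Bfun_const)
  have prod: "Bseq (\<lambda>m. (u m - U) * (v m - V))"
    by (intro Bseq_mult Bseq_diff_real u v c)
  then show ?bounded
    unfolding eq by (intro Bseq_diff_real c)
  show ?mean
    unfolding eq geo_mean_diff[OF q prod c] geo_mean_prod_diff[OF assms] geo_mean_const[OF q]
    by (simp add: U_V_P_def geo_cov_def)
qed

lemma geo_cov_le:
  assumes q: "0 < q" "q < 1" and B: "Bseq u" "Bseq v" "Bseq u'" "Bseq v'"
    and le: "\<And>j k. (u j - u k) * (v j - v k) \<le> (u' j - u' k) * (v' j - v' k)"
  shows "geo_cov q u v \<le> geo_cov q u' v'"
proof -
  have c: "Bseq (\<lambda>k::nat. x)" for x :: real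
    by (simp add: Bfun_const)
  have "2 * geo_cov q u v \<le> 2 * geo_cov q u' v'"
    unfolding geo_mean_geo_mean_diffs(2)[OF q B(1,2), symmetric]
      geo_mean_geo_mean_diffs(2)[OF q B(3,4), symmetric]
    by (intro geo_mean_mono geo_mean_geo_mean_diffs(1) Bseq_mult Bseq_diff_real c q B le)
  then show ?thesis by simp
qed

text \<open>Chebyshev's inequality for similarly ordered sequences.\<close>
lemma geo_cov_nonneg:
  assumes q: "0 < q" "q < 1" and B: "Bseq u" "Bseq v"
    and le: "\<And>j k. 0 \<le> (u j - u k) * (v j - v k)"
  shows "0 \<le> geo_cov q u v"
  using geo_cov_le[OF q, of "\<lambda>_. 0" "\<lambda>_. 0" u v] B le
  by (simp add: geo_cov_def geo_mean_const[OF q] Bfun_const)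

lemma geo_cov_cmult:
  assumes q: "0 < q" "q < 1" and B: "Bseq u" "Bseq v"
  shows "geo_cov q (\<lambda>k. s * u k) (\<lambda>k. t * v k) = s * t * geo_cov q u v"
  using geo_mean_cmult[OF q Bseq_mult[OF B], of "s * t"]
  by (simp add: geo_cov_def geo_mean_cmult[OF q] B algebra_simps)

text \<open>A Bhatia-Davis type bound, from the mean of \<open>(u k - m) (M - v k) \<ge> 0\<close>.\<close>
lemma geo_cov_le_bounds:
  assumes q: "0 < q" "q < 1" and B: "Bseq u" "Bseq v"
    and "\<And>k. m \<le> u k" "\<And>k. v k \<le> M"
  shows "geo_cov q u v \<le> (geo_mean q u - m) * (M - geo_mean q v)"
proof -
  have c: "Bseq (\<lambda>k::nat. x)" for x :: real
    by (simp add: Bfun_const)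
  have "geo_mean q (\<lambda>k. (u k - m) * (v k - M)) \<le> geo_mean q (\<lambda>_. 0)"
    using assms by (intro geo_mean_mono Bseq_mult Bseq_diff_real c) (auto intro: mult_nonneg_nonpos)
  then show ?thesis
    unfolding geo_mean_prod_diff[OF q B] geo_mean_const[OF q] geo_cov_def
    by (simp add: algebra_simps)
qed

lemma geo_mean_power2:
  assumes q: "0 < q" "q < 1"
  shows "geo_mean q (\<lambda>k. q ^ k * q ^ k) = 1 / q_number q 3"
proof -
  have "q ^ 3 < 1"
    using q by (simp add: power_less_one_iff)
  moreover have "(\<lambda>k. q ^ k * q ^ k * q ^ k) = (\<lambda>k. (q ^ 3) ^ k)"
    by (simp add: power3_eq_cube power_mult_distrib)
  ultimately show ?thesis
    using q by (simp add: geo_mean_def suminf_geometric q_number_def)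
qed

text \<open>The decomposition of the Chebyshev functional of the Jackson integral over \<open>[a,b]\<close>.\<close>
lemma q_integral_decomp:
  fixes f g :: "real \<Rightarrow> real" and q :: real
  defines "u \<equiv> \<lambda>c k. f (c * q ^ k)" and "v \<equiv> \<lambda>c k. g (c * q ^ k)"
  shows "(b - a) * q_integral q (\<lambda>x. f x * g x) a b - q_integral q f a b * q_integral q g a b
    = b * (b - a) * geo_cov q (u b) (v b) - a * (b - a) * geo_cov q (u a) (v a)
      - a * b * ((geo_mean q (u b) - geo_mean q (u a)) * (geo_mean q (v b) - geo_mean q (v a)))"
  unfolding q_integral_def q_integral0_eq_geo_mean geo_cov_def u_def v_def
  by (simp add: algebra_simps)

section \<open>Samples of an increasing function at geometric points\<close>

lemma geometric_point_in:
  assumes "0 < q" "q < (1::real)" "0 \<le> c" "c \<le> b"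
  shows "c * q ^ k \<in> {0..b}"
  using assms mult_left_mono[of "q ^ k" 1 c] by (simp add: power_le_one)

lemma mono_on_sample_bounds:
  fixes f :: "real \<Rightarrow> real"
  assumes "mono_on {0..b} f" "0 < q" "q < 1" "0 \<le> c" "c \<le> b"
  shows "f 0 \<le> f (c * q ^ k)" "f (c * q ^ k) \<le> f b"
  using geometric_point_in[OF assms(2-5), of k]
  by (auto intro!: mono_onD[OF assms(1)])

lemma Bseq_mono_on_sample:
  fixes f :: "real \<Rightarrow> real"
  assumes "mono_on {0..b} f" "0 < q" "q < 1" "0 \<le> c" "c \<le> b"
  shows "Bseq (\<lambda>k. f (c * q ^ k))"
proof (rule BseqI')
  show "norm (f (c * q ^ k)) \<le> \<bar>f 0\<bar> + \<bar>f b\<bar>" for k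
    using mono_on_sample_bounds[OF assms, of k] by (simp add: abs_le_iff) linarith
qed

lemma slope_bounds_prod:
  fixes f g :: "real \<Rightarrow> real"
  assumes f: "\<forall>x\<in>S. \<forall>y\<in>S. x \<noteq> y \<longrightarrow>
        l_f \<le> (f x - f y) / (x - y) \<and> (f x - f y) / (x - y) \<le> L_f"
    and g: "\<forall>x\<in>S. \<forall>y\<in>S. x \<noteq> y \<longrightarrow>
        l_g \<le> (g x - g y) / (x - y) \<and> (g x - g y) / (x - y) \<le> L_g"
    and pos: "0 \<le> l_f" "0 \<le> l_g" and S: "x \<in> S" "y \<in> S"
  shows "l_f * l_g * (x - y)\<^sup>2 \<le> (f x - f y) * (g x - g y)"
    and "(f x - f y) * (g x - g y) \<le> L_f * L_g * (x - y)\<^sup>2"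
proof -
  have "l_f * l_g * (x - y)\<^sup>2 \<le> (f x - f y) * (g x - g y)
      \<and> (f x - f y) * (g x - g y) \<le> L_f * L_g * (x - y)\<^sup>2"
  proof (cases "x = y")
    case False
    define r s where "r = (f x - f y) / (x - y)" and "s = (g x - g y) / (x - y)"
    have eq: "(f x - f y) * (g x - g y) = r * s * (x - y)\<^sup>2"
      using False by (simp add: r_def s_def power2_eq_square)
    have r: "l_f \<le> r" "r \<le> L_f" and s: "l_g \<le> s" "s \<le> L_g"
      using f g S False by (auto simp: r_def s_def)
    show ?thesis
      unfolding eq using r s pos by (intro conjI mult_right_mono mult_mono) auto
  qed simp
  then show "l_f * l_g * (x - y)\<^sup>2 \<le> (f x - f y) * (g x - g y)"
    and "(f x - f y) * (g x - g y) \<le> L_f * L_g * (x - y)\<^sup>2"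
    by auto
qed

text \<open>The shift of the sample mean of an increasing function when the points \<open>a q^k\<close> are
  replaced by \<open>b q^k\<close>.\<close>
lemma sample_mean_shift:
  fixes f :: "real \<Rightarrow> real"
  assumes mono: "mono_on {0..b} f" and q: "0 < q" "q < 1" and ab: "0 < a" "a < b"
    and L: "\<forall>x\<in>{0..b}. \<forall>y\<in>{0..b}. x \<noteq> y \<longrightarrow> (f x - f y) / (x - y) \<le> L"
  defines "D \<equiv> geo_mean q (\<lambda>k. f (b * q ^ k)) - geo_mean q (\<lambda>k. f (a * q ^ k))"
  shows "0 \<le> D" and "D \<le> L * (b - a) * geo_mean q (\<lambda>k. q ^ k)"
proof -
  have B: "Bseq (\<lambda>k. f (b * q ^ k))" "Bseq (\<lambda>k. f (a * q ^ k))" "Bseq (\<lambda>k. q ^ k)"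
    using Bseq_mono_on_sample[OF mono q] Bseq_geometric[OF q, of 1] ab by auto
  have D: "D = geo_mean q (\<lambda>k. f (b * q ^ k) - f (a * q ^ k))"
    unfolding D_def by (rule geo_mean_diff[OF q B(1,2), symmetric])
  have pt: "a * q ^ k \<in> {0..b}" "b * q ^ k \<in> {0..b}" "a * q ^ k < b * q ^ k" for k
    using geometric_point_in[OF q, of a b k] geometric_point_in[OF q, of b b k] ab q by auto
  have "0 \<le> f (b * q ^ k) - f (a * q ^ k)" for k
    using mono_onD[OF mono pt(1,2)] pt(3) by (simp add: less_imp_le)
  then have "geo_mean q (\<lambda>_. 0) \<le> D"
    unfolding D by (intro geo_mean_mono q Bseq_diff_real B) (auto simp: Bfun_const)
  then show "0 \<le> D"
    by (simp add: geo_mean_const[OF q])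
  have "f (b * q ^ k) - f (a * q ^ k) \<le> L * (b - a) * q ^ k" for k
  proof -
    have "(f (b * q ^ k) - f (a * q ^ k)) / (b * q ^ k - a * q ^ k) \<le> L"
      using bspec[OF bspec[OF L pt(2)] pt(1), of k k] less_imp_neq[OF pt(3)[of k]] by metis
    then have "f (b * q ^ k) - f (a * q ^ k) \<le> L * (b * q ^ k - a * q ^ k)"
      using pt(3)[of k] by (subst (asm) pos_divide_le_eq) auto
    then show ?thesis
      by (simp only: left_diff_distrib right_diff_distrib mult.assoc)
  qed
  then have "D \<le> geo_mean q (\<lambda>k. L * (b - a) * q ^ k)"
    unfolding D by (intro geo_mean_mono q Bseq_diff_real Bseq_geometric B)
  then show "D \<le> L * (b - a) * geo_mean q (\<lambda>k. q ^ k)"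
    by (simp add: geo_mean_cmult[OF q B(3)])
qed

lemma sample_cov_bounds:
  fixes f g :: "real \<Rightarrow> real"
  assumes mono: "mono_on {0..b} f" "mono_on {0..b} g"
    and q: "0 < q" "q < 1" and c: "0 \<le> c" "c \<le> b"
    and f: "\<forall>x\<in>{0..b}. \<forall>y\<in>{0..b}. x \<noteq> y \<longrightarrow>
        l_f \<le> (f x - f y) / (x - y) \<and> (f x - f y) / (x - y) \<le> L_f"
    and g: "\<forall>x\<in>{0..b}. \<forall>y\<in>{0..b}. x \<noteq> y \<longrightarrow>
        l_g \<le> (g x - g y) / (x - y) \<and> (g x - g y) / (x - y) \<le> L_g"
    and pos: "0 \<le> l_f" "0 \<le> l_g"
  defines "C \<equiv> geo_cov q (\<lambda>k. f (c * q ^ k)) (\<lambda>k. g (c * q ^ k))"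
    and "V \<equiv> geo_cov q (\<lambda>k. q ^ k) (\<lambda>k. q ^ k)"
  shows "l_f * l_g * c\<^sup>2 * V \<le> C" and "C \<le> L_f * L_g * c\<^sup>2 * V"
proof -
  have B: "Bseq (\<lambda>k. f (c * q ^ k))" "Bseq (\<lambda>k. g (c * q ^ k))" "Bseq (\<lambda>k. q ^ k)"
    "\<And>t. Bseq (\<lambda>k. t * q ^ k)"
    using Bseq_mono_on_sample[OF _ q c] mono Bseq_geometric[OF q, of 1] Bseq_geometric[OF q] by auto
  have scale: "s * t * c\<^sup>2 * V = geo_cov q (\<lambda>k. (s * c) * q ^ k) (\<lambda>k. (t * c) * q ^ k)" for s t
    unfolding geo_cov_cmult[OF q B(3,3)] V_def by (simp add: power2_eq_square)
  have sq: "(s * c * q ^ j - s * c * q ^ k) * (t * c * q ^ j - t * c * q ^ k)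
      = s * t * (c * q ^ j - c * q ^ k)\<^sup>2" for s t j k
    by (simp add: power2_eq_square algebra_simps)
  note slope = slope_bounds_prod[where S = "{0..b}", OF f g pos geometric_point_in[OF q c]
      geometric_point_in[OF q c]]
  show "l_f * l_g * c\<^sup>2 * V \<le> C"
    unfolding scale C_def by (intro geo_cov_le q B) (simp only: sq slope(1))
  show "C \<le> L_f * L_g * c\<^sup>2 * V"
    unfolding scale C_def by (intro geo_cov_le q B) (simp only: sq slope(2))
qed

section \<open>The two Chebyshev-type inequalities\<close>

text \<open>For an increasing function, the hypothesis on the ratio of the slope bounds forces both of
  them to be positive; \<open>L = 0\<close> is excluded because then \<open>l / L = 0\<close>.\<close>
lemma slope_ratio_pos:
  fixes f :: "real \<Rightarrow> real"
  assumes "mono_on {0..b} f" "0 < a" "a < b" "a\<^sup>2 / b\<^sup>2 \<le> l / L"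
    and "\<forall>x\<in>{0..b}. \<forall>y\<in>{0..b}. x \<noteq> y \<longrightarrow> (f x - f y) / (x - y) \<le> L"
  shows "0 < l" "0 < L" "a\<^sup>2 * L \<le> l * b\<^sup>2"
proof -
  have "f 0 \<le> f b"
    using assms(1-3) by (auto intro: mono_onD)
  then have "0 \<le> L"
    using bspec[OF bspec[OF assms(5), of b], of 0] assms(2,3)
    by (smt (verit) atLeastAtMost_iff divide_nonneg_pos)
  moreover have ratio: "0 < l / L"
    using assms(2-4) by (smt (verit) zero_less_divide_iff zero_less_power)
  ultimately show L: "0 < L" and l: "0 < l"
    by (auto simp: zero_less_divide_iff)
  show "a\<^sup>2 * L \<le> l * b\<^sup>2"
    using assms(2-4) L by (simp add: field_simps)
qed

text \<open>The arithmetic behind (a): \<open>Cb, Ca\<close> are the covariances, \<open>Df, Dg\<close> the shifts of the means,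
  \<open>V, M\<close> the variance and mean of \<open>q^k\<close>.\<close>
lemma lower_bound_a:
  fixes a b :: real
  assumes ab: "0 < a" "a < b" and V: "0 \<le> V" and M: "0 \<le> M"
    and lL: "a\<^sup>2 * L_f \<le> l_f * b\<^sup>2" "a\<^sup>2 * L_g \<le> l_g * b\<^sup>2"
    and pos: "0 < L_f" "0 < L_g" "0 < l_f" "0 < l_g"
    and Cb: "l_f * l_g * b\<^sup>2 * V \<le> Cb" and Ca: "Ca \<le> L_f * L_g * a\<^sup>2 * V"
    and Df: "0 \<le> Df" "Df \<le> L_f * (b - a) * M" and Dg: "0 \<le> Dg" "Dg \<le> L_g * (b - a) * M"
  shows "b * (b - a) * Cb - a * (b - a) * Ca - a * b * (Df * Dg)
    \<ge> - (a * b * (b - a)\<^sup>2 * (V + M\<^sup>2) * (L_f * L_g))"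
proof -
  define K where "K = L_f * L_g"
  have K: "0 < K"
    using pos by (simp add: K_def)
  have "(a\<^sup>2 * L_f) * (a\<^sup>2 * L_g) \<le> (l_f * b\<^sup>2) * (l_g * b\<^sup>2)"
    using lL pos by (intro mult_mono[OF lL]) auto
  moreover have "(a\<^sup>2 * L_f) * (a\<^sup>2 * L_g) = a ^ 4 * K"
    and "(l_f * b\<^sup>2) * (l_g * b\<^sup>2) = l_f * l_g * b ^ 4"
    by (simp_all add: K_def power2_eq_square power4_eq_xxxx)
  ultimately have "a ^ 4 * K * V \<le> (l_f * l_g * b ^ 4) * V"
    using V by (intro mult_right_mono) auto
  also have "\<dots> = b\<^sup>2 * (l_f * l_g * b\<^sup>2 * V)"
    by (simp add: power2_eq_square power4_eq_xxxx)
  also have "\<dots> \<le> b\<^sup>2 * Cb"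
    using Cb by (intro mult_left_mono) auto
  finally have Cb': "a ^ 4 * K * V \<le> b\<^sup>2 * Cb" .
  have Ca': "a * b * Ca \<le> a * b * (K * a\<^sup>2 * V)"
    using Ca ab by (intro mult_left_mono) (auto simp: K_def)
  \<comment> \<open>The bounds on \<open>Cb\<close> and \<open>Ca\<close> leave the deficit \<open>a^3 (b - a) K V\<close>, where \<open>a^2 \<le> b^2\<close>.\<close>
  have "a\<^sup>2 * (a * (b - a) * (K * V)) \<le> b\<^sup>2 * (a * (b - a) * (K * V))"
    using ab K V by (intro mult_right_mono power_mono) auto
  then have "- (b * (a * b * (b - a) * K * V)) \<le> b\<^sup>2 * Cb - a * b * Ca"
    using Cb' Ca' by (simp add: power2_eq_square power4_eq_xxxx algebra_simps)
  then have "b * (- (a * b * (b - a) * K * V)) \<le> b * (b * Cb - a * Ca)"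
    by (simp add: power2_eq_square algebra_simps)
  then have "- (a * b * (b - a) * K * V) \<le> b * Cb - a * Ca"
    using ab by (subst (asm) mult_le_cancel_left_pos) auto
  then have cov: "(b - a) * (- (a * b * (b - a) * K * V)) \<le> (b - a) * (b * Cb - a * Ca)"
    using ab by (intro mult_left_mono) auto
  have "a * b * (Df * Dg) \<le> a * b * ((L_f * (b - a) * M) * (L_g * (b - a) * M))"
    using ab Df Dg by (intro mult_left_mono mult_mono) auto
  then show ?thesis
    using cov by (simp add: K_def power2_eq_square algebra_simps)
qed

text \<open>The arithmetic behind (b): \<open>Ef, Eg\<close> are the means over the points \<open>a q^k\<close>, and \<open>f0, f1\<close>
  and \<open>g0, g1\<close> the values of the two functions at \<open>0\<close> and \<open>b\<close>.\<close>
lemma lower_bound_b: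
  fixes a b :: real
  assumes ab: "0 < a" "a < b"
    and Cb: "0 \<le> Cb" and Ca: "Ca \<le> (Ef - f0) * (g1 - Eg)"
    and Df: "0 \<le> Df" "Df \<le> f1 - Ef" and Dg: "0 \<le> Dg" "Dg \<le> g1 - Eg"
    and E: "f0 \<le> Ef" "g0 \<le> Eg"
  shows "b * (b - a) * Cb - a * (b - a) * Ca - a * b * (Df * Dg)
    \<ge> - (a * b * ((f1 - f0) * (g1 - g0)))"
proof -
  have X: "0 \<le> (Ef - f0) * (g1 - Eg)"
    using E Dg by (intro mult_nonneg_nonneg) auto
  have "a * (b - a) * Ca \<le> a * (b - a) * ((Ef - f0) * (g1 - Eg))"
    using ab Ca by (intro mult_left_mono) auto
  also have "\<dots> \<le> a * b * ((Ef - f0) * (g1 - Eg))"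
    using ab X by (intro mult_right_mono mult_left_mono) auto
  finally have "a * (b - a) * Ca \<le> a * b * ((Ef - f0) * (g1 - Eg))" .
  moreover have "a * b * (Df * Dg) \<le> a * b * ((f1 - Ef) * (g1 - Eg))"
    using ab Df Dg by (intro mult_left_mono mult_mono) auto
  moreover have "a * b * ((f1 - f0) * (g1 - Eg)) \<le> a * b * ((f1 - f0) * (g1 - g0))"
    using ab Df E by (intro mult_left_mono) auto
  moreover have "0 \<le> b * (b - a) * Cb"
    using ab Cb by simp
  ultimately show ?thesis
    by (simp add: algebra_simps)
qed

theorem theorem3p3:
  fixes q a b l_f L_f l_g L_g :: real and f g :: "real \<Rightarrow> real"
  assumes "0 < q" and "q < 1" and "0 < a" and "a < b"
    and "mono_on {0..b} f" and "mono_on {0..b} g"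
    and "a\<^sup>2 / b\<^sup>2 \<le> l_f / L_f" and "a\<^sup>2 / b\<^sup>2 \<le> l_g / L_g"
    and "\<And>x y. x \<in> {0..b} \<Longrightarrow> y \<in> {0..b} \<Longrightarrow> x \<noteq> y \<Longrightarrow>
           l_f \<le> (f x - f y) / (x - y) \<and> (f x - f y) / (x - y) \<le> L_f"
    and "\<And>x y. x \<in> {0..b} \<Longrightarrow> y \<in> {0..b} \<Longrightarrow> x \<noteq> y \<Longrightarrow>
           l_g \<le> (g x - g y) / (x - y) \<and> (g x - g y) / (x - y) \<le> L_g"
  shows "q_integral q (\<lambda>x. f x * g x) a b
           \<ge> 1 / (b - a) * q_integral q f a b * q_integral q g a b
              - a * b * (b - a) / q_number q 3 * L_f * L_g
         \<and> q_integral q (\<lambda>x. f x * g x) a b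
           \<ge> 1 / (b - a) * q_integral q f a b * q_integral q g a b
              - a * b / (b - a) * (f b - f 0) * (g b - g 0)"
proof -
  note q = assms(1,2) and ab = assms(3,4) and mono = assms(5,6)
  have f: "\<forall>x\<in>{0..b}. \<forall>y\<in>{0..b}. x \<noteq> y \<longrightarrow>
      l_f \<le> (f x - f y) / (x - y) \<and> (f x - f y) / (x - y) \<le> L_f"
    and g: "\<forall>x\<in>{0..b}. \<forall>y\<in>{0..b}. x \<noteq> y \<longrightarrow>
      l_g \<le> (g x - g y) / (x - y) \<and> (g x - g y) / (x - y) \<le> L_g"
    using assms(9,10) by blast+
  then have slope: "\<forall>x\<in>{0..b}. \<forall>y\<in>{0..b}. x \<noteq> y \<longrightarrow> (f x - f y) / (x - y) \<le> L_f"
    "\<forall>x\<in>{0..b}. \<forall>y\<in>{0..b}. x \<noteq> y \<longrightarrow> (g x - g y) / (x - y) \<le> L_g"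
    by blast+
  note pos_f = slope_ratio_pos[OF mono(1) ab assms(7) slope(1)]
    and pos_g = slope_ratio_pos[OF mono(2) ab assms(8) slope(2)]
  define V M where "V = geo_cov q (\<lambda>k. q ^ k) (\<lambda>k. q ^ k)" and "M = geo_mean q (\<lambda>k. q ^ k)"
  define Ef Eg where "Ef = geo_mean q (\<lambda>k. f (a * q ^ k))" and "Eg = geo_mean q (\<lambda>k. g (a * q ^ k))"
  define Df Dg where "Df = geo_mean q (\<lambda>k. f (b * q ^ k)) - Ef"
    and "Dg = geo_mean q (\<lambda>k. g (b * q ^ k)) - Eg"
  define Ca Cb where "Ca = geo_cov q (\<lambda>k. f (a * q ^ k)) (\<lambda>k. g (a * q ^ k))"
    and "Cb = geo_cov q (\<lambda>k. f (b * q ^ k)) (\<lambda>k. g (b * q ^ k))"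
  define T where "T = (b - a) * q_integral q (\<lambda>x. f x * g x) a b
    - q_integral q f a b * q_integral q g a b"
  have T: "T = b * (b - a) * Cb - a * (b - a) * Ca - a * b * (Df * Dg)"
    unfolding T_def q_integral_decomp Ca_def Cb_def Df_def Dg_def Ef_def Eg_def ..
  have Bq: "Bseq (\<lambda>k. q ^ k)"
    using Bseq_geometric[OF q, of 1] by simp
  have "0 \<le> V"
    unfolding V_def by (intro geo_cov_nonneg q Bq) simp
  have "0 \<le> M"
    unfolding M_def by (rule geo_mean_bounds(1)[OF q Bq, of _ 1]) (use q in \<open>auto simp: power_le_one\<close>)
  have V_M: "V + M\<^sup>2 = 1 / q_number q 3"
    unfolding V_def M_def geo_cov_def geo_mean_power2[OF q, symmetric] by (simp add: power2_eq_square)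
  note cov_bounds = sample_cov_bounds[OF mono q _ _ f g less_imp_le[OF pos_f(1)]
      less_imp_le[OF pos_g(1)], folded V_def]
  have Cb: "l_f * l_g * b\<^sup>2 * V \<le> Cb"
    unfolding Cb_def using ab by (intro cov_bounds(1)) auto
  have Ca: "Ca \<le> L_f * L_g * a\<^sup>2 * V"
    unfolding Ca_def using ab by (intro cov_bounds(2)) auto
  note Df = sample_mean_shift[OF mono(1) q ab slope(1), folded Ef_def, folded Df_def M_def]
    and Dg = sample_mean_shift[OF mono(2) q ab slope(2), folded Eg_def, folded Dg_def M_def]
  have divide: "q_integral q (\<lambda>x. f x * g x) a b
      \<ge> 1 / (b - a) * q_integral q f a b * q_integral q g a b - X"
    if "T \<ge> - ((b - a) * X)" for X
  proof -
    have "(b - a) * (1 / (b - a) * q_integral q f a b * q_integral q g a b - X)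
        = q_integral q f a b * q_integral q g a b - (b - a) * X"
      using ab by (simp add: right_diff_distrib)
    also have "\<dots> \<le> (b - a) * q_integral q (\<lambda>x. f x * g x) a b"
      using that by (simp add: T_def)
    finally show ?thesis
      using ab by (subst (asm) mult_le_cancel_left_pos) auto
  qed

  have "(b - a) * (a * b * (b - a) / q_number q 3 * L_f * L_g)
      = a * b * (b - a)\<^sup>2 * (V + M\<^sup>2) * (L_f * L_g)"
    unfolding V_M by (simp add: power2_eq_square)
  then have a: "T \<ge> - ((b - a) * (a * b * (b - a) / q_number q 3 * L_f * L_g))"
    unfolding T using lower_bound_a[OF ab \<open>0 \<le> V\<close> \<open>0 \<le> M\<close> pos_f(3) pos_g(3) pos_f(2) pos_g(2)
        pos_f(1) pos_g(1) Cb Ca Df Dg] by simp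

  have "0 \<le> l_f * l_g * b\<^sup>2 * V"
    using pos_f(1) pos_g(1) \<open>0 \<le> V\<close> by simp
  then have Cb_nonneg: "0 \<le> Cb"
    using Cb by linarith
  have B: "Bseq (\<lambda>k. f (c * q ^ k))" "Bseq (\<lambda>k. g (c * q ^ k))" if "0 \<le> c" "c \<le> b" for c
    using Bseq_mono_on_sample[OF _ q that] mono by auto
  note sample = mono_on_sample_bounds[OF mono(1) q] mono_on_sample_bounds[OF mono(2) q]
  have Ca': "Ca \<le> (Ef - f 0) * (g b - Eg)"
    unfolding Ca_def Ef_def Eg_def using ab by (intro geo_cov_le_bounds q B sample) auto
  have E: "f 0 \<le> Ef" "g 0 \<le> Eg"
    unfolding Ef_def Eg_def using ab
    by (auto intro!: geo_mean_bounds(1)[OF q] B sample)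
  have "Df \<le> f b - Ef" "Dg \<le> g b - Eg"
    unfolding Df_def Dg_def using ab
    by (auto intro!: diff_right_mono geo_mean_bounds(2)[OF q] B sample)
  then have "T \<ge> - (a * b * ((f b - f 0) * (g b - g 0)))"
    unfolding T using lower_bound_b[OF ab Cb_nonneg Ca' Df(1) _ Dg(1) _ E] by blast
  then have b: "T \<ge> - ((b - a) * (a * b / (b - a) * (f b - f 0) * (g b - g 0)))"
    using ab by (simp add: mult.assoc)
  show ?thesis
    using divide[OF a] divide[OF b] by blast
qed

end
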